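(* Let $\mathcal{L}:[0,\infty)\to[1,\infty)$ be monotone increasing with $\mathcal{L}(0)=1$ and $M:=1+\int_0^\infty\frac{dt}{(t+1)\mathcal{L}(t)}<\infty$. Then the sets $\mathcal{S}(1,\mathcal{L};1,2M)$, $\mathcal{S}(1,\mathcal{L};2,4M)$ and $\mathcal{S}(1,\mathcal{L};8,8M)$ contain admissible cutoff functions $\hat a$ of types (a), (b), and (c), respectively, with values in $[0,1]$.
   Context: For $\gamma,\tilde\gamma>0$, $\mathcal{S}(1,\mathcal{L};\gamma,\tilde\gamma)$ is the set of all $\hat a\in C^\infty[0,\infty)$ such that $\|\hat a\|_\infty\le\gamma$ and $\frac1{k!}\|\hat a^{(k)}\|_\infty\le\gamma(\tilde\gamma\mathcal{L}(k-1))^k$ for all $k\in\mathbb{N}=\{1,2,\dots\}$. A function $\hat a\in C^\infty[0,\infty)$ is admissible if $\operatorname{supp}\hat a\subset[0,2]$ and $\hat a^{(m)}(0)=0$ for $m\ge1$. It is admissible of type (a) if in addition $\hat a(t)=1$ for $t\in[0,1]$; of type (b) if in addition $\operatorname{supp}\hat a\subset[1/2,2]$; of type (c) if in addition $\operatorname{supp}\hat a\subset[1/2,2]$ and $\sum_{j=0}^\infty|\hat a(2^{-j}t)|^2=1$ for $t\in[1,\infty)$. *)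

theory Defs
  imports "HOL-Analysis.Analysis"
begin

text \<open>
  Functions on \<open>[0,\<infinity>)\<close> are represented by total functions on the reals; every notion below
  depends only on their values on \<open>{0..}\<close>. Derivatives are taken within \<open>{0..}\<close>, hence
  they are one-sided at \<open>0\<close>.
\<close>

definition nderiv :: "nat \<Rightarrow> (real \<Rightarrow> real) \<Rightarrow> real \<Rightarrow> real" where
  "nderiv k f = ((\<lambda>g t. vector_derivative g (at t within {0..})) ^^ k) f"

definition C_infinity :: "(real \<Rightarrow> real) set" where
  "C_infinity = {f. \<forall>k. nderiv k f differentiable_on {0..}}"

text \<open>The supremum norm is \<open>ereal\<close>-valued, so that it is \<open>\<infinity>\<close> for unbounded functions.\<close>

definition sup_norm :: "(real \<Rightarrow> real) \<Rightarrow> ereal" where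
  "sup_norm f = (SUP t\<in>{0..}. ereal \<bar>f t\<bar>)"

text \<open>This is \<open>S(1, L; \<gamma>, \<gamma>')\<close>, with the first parameter fixed to \<open>1\<close>.\<close>

definition S_one :: "(real \<Rightarrow> real) \<Rightarrow> real \<Rightarrow> real \<Rightarrow> (real \<Rightarrow> real) set" where
  "S_one L \<gamma> \<gamma>' =
     {a \<in> C_infinity. sup_norm a \<le> ereal \<gamma> \<and>
        (\<forall>k\<ge>1. ereal (1 / fact k) * sup_norm (nderiv k a)
                 \<le> ereal (\<gamma> * (\<gamma>' * L (real k - 1)) ^ k))}"

definition supp :: "(real \<Rightarrow> real) \<Rightarrow> real set" where
  "supp a = closure {t \<in> {0..}. a t \<noteq> 0}"

definition admissible :: "(real \<Rightarrow> real) \<Rightarrow> bool" where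
  "admissible a \<longleftrightarrow> a \<in> C_infinity \<and> supp a \<subseteq> {0..2} \<and> (\<forall>m\<ge>1. nderiv m a 0 = 0)"

definition admissible_a :: "(real \<Rightarrow> real) \<Rightarrow> bool" where
  "admissible_a a \<longleftrightarrow> admissible a \<and> (\<forall>t\<in>{0..1}. a t = 1)"

definition admissible_b :: "(real \<Rightarrow> real) \<Rightarrow> bool" where
  "admissible_b a \<longleftrightarrow> admissible a \<and> supp a \<subseteq> {1/2..2}"

definition admissible_c :: "(real \<Rightarrow> real) \<Rightarrow> bool" where
  "admissible_c a \<longleftrightarrow> admissible a \<and> supp a \<subseteq> {1/2..2} \<and>
     (\<forall>t\<ge>1. (\<lambda>j::nat. \<bar>a (2 powi (- int j) * t)\<bar>\<^sup>2) sums 1)"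

end

theory Submission
  imports Defs
begin

text \<open>
  The cutoff of type (a) is an infinite convolution of box functions. Averaging a function over a
  window of length \<open>a\<close> turns its derivative into a difference quotient of step \<open>a\<close>, so each
  window pays for one derivative, at the price of a factor \<open>2 / a\<close>, and prolongs a descent from
  \<open>1\<close> to \<open>0\<close> by \<open>a\<close>. The step function that drops from \<open>1\<close> to \<open>0\<close> at the origin, averaged over windows
  \<open>a\<^sub>0, a\<^sub>1, \<dots>\<close>, therefore becomes a smooth function that is \<open>1\<close> up to \<open>0\<close>, vanishes
  from \<open>\<Sum>\<^sub>j a\<^sub>j\<close> on, and whose derivative of order \<open>k + 1\<close> is at most
  \<open>2\<^sup>k / (a\<^sub>0 \<cdots> a\<^sub>k)\<close>: one of the \<open>k + 1\<close> windows costs only \<open>1 / a\<^sub>j\<close>, because the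
  innermost difference is between two values in \<open>[0,1]\<close>.

  Take \<open>a\<^sub>j = 1 / (M (j + 1) L(j))\<close>. Comparing the sum with the integral that defines \<open>M\<close> gives
  \<open>\<Sum>\<^sub>j a\<^sub>j \<le> 1\<close>, so the descent fits into \<open>[1,2]\<close> after a shift; and
  \<open>1 / (a\<^sub>0 \<cdots> a\<^sub>k) \<le> (k + 1)! (M L(k))\<^bsup>k + 1\<^esup>\<close> by monotonicity of \<open>L\<close>. This is
  \<open>smooth_cutoff_exists\<close>, which yields type (a).

  The partial averages increase with the number of windows. Hence they converge, and
  monotone convergence shows that the limits \<open>F\<^sub>n\<close>, for the windows \<open>a\<^sub>n, a\<^sub>n\<^sub>+\<^sub>1, \<dots>\<close>,
  satisfy \<open>F\<^sub>n = avg a\<^sub>n F\<^sub>n\<^sub>+\<^sub>1\<close>. Smoothness and all derivative bounds follow from these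
  equations alone, by induction on the order; no limit of derivatives is taken.

  From a type (a) function \<open>\<phi>\<close>, type (b) is obtained as \<open>b(t) = \<phi>(t) - \<phi>(2t)\<close>. The two
  terms vary on the intervals \<open>[1,2]\<close> and \<open>[1/2,1]\<close>, so at each point at most one of them
  contributes to a derivative. Type (c) is \<open>sin (\<pi>/2 b(t))\<close>: for \<open>t\<close> in \<open>[1,2]\<close> the values at
  \<open>t\<close> and \<open>t/2\<close> are the sine and the cosine of \<open>\<pi>/2 \<phi>(t)\<close>, and these are the only terms
  in the dyadic sum. Its derivatives are imaginary parts of those of \<open>exp (i \<pi>/2 b)\<close>, for which
  the Leibniz rule gives a recursion; as \<open>\<pi>/2 \<le> 2\<close>, it loses only a factor \<open>2\<^sup>k\<close> at order
  \<open>k\<close> (\<open>cis_tower_bound\<close>).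
\<close>

section \<open>Functions given with all their derivatives\<close>

text \<open>
  Smooth functions are handled together with an explicit sequence of candidates for their
  derivatives on the whole line. Evaluating \<open>nderiv\<close> and verifying \<open>C_infinity\<close> then reduce to
  two-sided first derivatives.
\<close>

definition derivative_tower :: "(nat \<Rightarrow> real \<Rightarrow> real) \<Rightarrow> bool" where
  "derivative_tower g \<longleftrightarrow> (\<forall>k t. (g k has_real_derivative g (Suc k) t) (at t))"

lemma nderiv_eq_tower:
  assumes g: "derivative_tower g" and t: "t \<ge> 0"
  shows "nderiv k (g 0) t = g k t"
  using t
proof (induction k arbitrary: t)
  case 0
  then show ?case by (simp add: nderiv_def)
next
  case (Suc k)
  have "(g k has_vector_derivative g (Suc k) t) (at t within {0..})"
    using g by (auto simp: derivative_tower_def has_real_derivative_iff_has_vector_derivative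
        intro: has_vector_derivative_at_within)
  then have "(nderiv k (g 0) has_vector_derivative g (Suc k) t) (at t within {0..})"
    by (rule has_vector_derivative_transform[rotated 2]) (use Suc in auto)
  moreover have "at t within {0..} \<noteq> bot"
  proof -
    have "t islimpt {t..t+1}" by (simp add: islimpt_Icc)
    then have "t islimpt {0..}" by (rule islimpt_subset) (use Suc in auto)
    then show ?thesis by (simp add: trivial_limit_within)
  qed
  ultimately show ?case
    by (simp add: nderiv_def vector_derivative_within)
qed

lemma tower_C_infinity:
  assumes g: "derivative_tower g"
  shows "g 0 \<in> C_infinity"
proof -
  have "nderiv k (g 0) differentiable_on {0..}" for k
  proof -
    have "g k differentiable_on {0..}"
      using g unfolding derivative_tower_def differentiable_on_def
      by (meson differentiable_at_withinI real_differentiable_def)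
    then show ?thesis
      unfolding differentiable_on_def
      by (auto intro: differentiable_transform_within[where f = "g k" and d = 1]
          simp: nderiv_eq_tower[OF g])
  qed
  then show ?thesis by (simp add: C_infinity_def)
qed

lemma tower_S_one:
  assumes g: "derivative_tower g" 
    and b0: "\<And>t. t \<ge> 0 \<Longrightarrow> \<bar>g 0 t\<bar> \<le> \<gamma>"
    and b: "\<And>k t. t \<ge> 0 \<Longrightarrow> k \<ge> 1 \<Longrightarrow> \<bar>g k t\<bar> \<le> fact k * (\<gamma> * (\<gamma>' * L (real k - 1)) ^ k)"
  shows "g 0 \<in> S_one L \<gamma> \<gamma>'"
proof -
  have "ereal (1 / fact k) * sup_norm (nderiv k (g 0)) \<le> ereal (\<gamma> * (\<gamma>' * L (real k - 1)) ^ k)"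
    if k: "k \<ge> 1" for k
  proof -
    have "sup_norm (nderiv k (g 0)) \<le> ereal (fact k * (\<gamma> * (\<gamma>' * L (real k - 1)) ^ k))"
      unfolding sup_norm_def
      by (rule SUP_least) (use k b in \<open>auto simp: nderiv_eq_tower[OF g]\<close>)
    then have "ereal (1 / fact k) * sup_norm (nderiv k (g 0))
        \<le> ereal (1 / fact k) * ereal (fact k * (\<gamma> * (\<gamma>' * L (real k - 1)) ^ k))"
      by (rule ereal_mult_left_mono) simp
    then show ?thesis by simp
  qed
  moreover have "sup_norm (g 0) \<le> ereal \<gamma>"
    unfolding sup_norm_def by (rule SUP_least) (use b0 in auto)
  ultimately show ?thesis
    using tower_C_infinity[OF g] by (simp add: S_one_def)
qed

lemma supp_subset:
  assumes "\<And>t. 0 \<le> t \<Longrightarrow> a t \<noteq> 0 \<Longrightarrow> u \<le> t \<and> t \<le> v"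
  shows "supp a \<subseteq> {u..v}"
  unfolding supp_def by (rule closure_minimal) (use assms in auto)

lemma tower_admissible:
  assumes g: "derivative_tower g" and "supp (g 0) \<subseteq> {0..2}" and "\<And>k. k \<ge> 1 \<Longrightarrow> g k 0 = 0"
  shows "admissible (g 0)"
  using assms tower_C_infinity[OF g] by (simp add: admissible_def nderiv_eq_tower[OF g])

text \<open>
  The left derivative alone determines the derivative. This handles the endpoint of an interval
  of constancy together with its interior.
\<close>

lemma derivative_zero_if_constant_left:
  fixes f :: "real \<Rightarrow> real"
  assumes "(f has_real_derivative d) (at x)" "\<And>y. y \<le> x \<Longrightarrow> f y = c"
  shows "d = 0"
proof -
  have "(f has_vector_derivative d) (at x within {..x})"
    using assms(1) by (simp add: has_real_derivative_iff_has_vector_derivative has_vector_derivative_at_within)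
  moreover have "(f has_vector_derivative 0) (at x within {..x})"
    by (rule has_vector_derivative_transform[where f="\<lambda>_. c"]) (use assms(2) in auto)
  moreover have "at x within {..x} \<noteq> bot"
  proof -
    have "x islimpt {x-1..x}" by (simp add: islimpt_Icc)
    then have "x islimpt {..x}" by (rule islimpt_subset) auto
    then show ?thesis by (simp add: trivial_limit_within)
  qed
  ultimately show ?thesis by (metis vector_derivative_within)
qed

lemma tower_zero_if_constant_left:
  assumes g: "derivative_tower g" and c: "\<And>t. t \<le> x \<Longrightarrow> g 0 t = c" and k: "k \<ge> 1" and t: "t \<le> x"
  shows "g k t = 0"
  using k t
proof (induction k arbitrary: t rule: nat_induct_at_least)
  case base
  have "(g 0 has_real_derivative g 1 t) (at t)"
    using g by (simp add: derivative_tower_def)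
  then show ?case
    by (rule derivative_zero_if_constant_left) (use c base in auto)
next
  case (Suc n)
  have "(g n has_real_derivative g (Suc n) t) (at t)"
    using g by (simp add: derivative_tower_def)
  then show ?case
    by (rule derivative_zero_if_constant_left) (use Suc in auto)
qed

text \<open>
  The chain rule for dilations, translations and (with \<open>r = -1\<close>) reflections at once.
\<close>

lemma tower_affine:
  assumes g: "derivative_tower g"
  shows "derivative_tower (\<lambda>k t. r ^ k * g k (r * t + s))"
  unfolding derivative_tower_def
proof (intro allI)
  fix k t
  have "(g k has_real_derivative g (Suc k) (r * t + s)) (at (r * t + s))"
    using g by (simp add: derivative_tower_def)
  then have "((\<lambda>t. g k (r * t + s)) has_real_derivative g (Suc k) (r * t + s) * r) (at t)"
    by (rule DERIV_chain2) (auto intro!: derivative_eq_intros)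
  from DERIV_cmult[OF this, of "r ^ k"]
  show "((\<lambda>t. r ^ k * g k (r * t + s)) has_real_derivative r ^ Suc k * g (Suc k) (r * t + s)) (at t)"
    by (simp add: mult_ac)
qed

lemma tower_diff:
  assumes "derivative_tower f" "derivative_tower g"
  shows "derivative_tower (\<lambda>k t. f k t - g k t)"
  using assms unfolding derivative_tower_def by (auto intro!: derivative_intros)

lemma tower_cmult:
  assumes "derivative_tower f"
  shows "derivative_tower (\<lambda>k t. c * f k t)"
  using assms unfolding derivative_tower_def by (auto intro!: DERIV_cmult)

lemma tower_zero_if_constant_right:
  assumes g: "derivative_tower g" and c: "\<And>t. t \<ge> x \<Longrightarrow> g 0 t = c" and k: "k \<ge> 1" and t: "t \<ge> x"
  shows "g k t = 0"
  using tower_zero_if_constant_left[OF tower_affine[OF g, of "-1" 0], of "-x" c k "-t"] assms by simp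

section \<open>Averaging over a window\<close>

definition avg :: "real \<Rightarrow> (real \<Rightarrow> real) \<Rightarrow> real \<Rightarrow> real" where
  "avg a f x = integral {x - a..x} f / a"

lemma antimono_integrable:
  fixes f :: "real \<Rightarrow> real"
  assumes "antimono f"
  shows "f integrable_on {u..v}"
proof -
  have "(\<lambda>x. - f x) integrable_on {u..v}"
    by (rule integrable_on_mono_on) (use assms in \<open>auto simp: antimono_def mono_on_def\<close>)
  from integrable_neg[OF this] show ?thesis by simp
qed

lemma avg_const:
  assumes "a > 0" "\<And>y. x - a \<le> y \<Longrightarrow> y \<le> x \<Longrightarrow> f y = c"
  shows "avg a f x = c"
proof -
  have "integral {x - a..x} f = integral {x - a..x} (\<lambda>_. c)"
    by (rule integral_cong) (use assms in auto)
  then show ?thesis using assms by (simp add: avg_def)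
qed

lemma avg_mono:
  assumes "a > 0" "antimono f" "antimono g" "\<And>y. f y \<le> g y"
  shows "avg a f x \<le> avg a g x"
  unfolding avg_def
  by (intro divide_right_mono integral_le antimono_integrable) (use assms in auto)

lemma avg_antimono:
  assumes a: "a > 0" and f: "antimono f"
  shows "antimono (avg a f)"
proof (rule antimonoI)
  fix x y :: real assume xy: "x \<le> y"
  have "(f has_integral integral {y-a..y} f) {y-a..y}"
    using antimono_integrable[OF f] by (simp add: integrable_integral)
  from has_integral_affinity[of f _ "y-a" y 1 "y-x"] this
  have "((\<lambda>z. f (z + (y - x))) has_integral integral {y-a..y} f) {x-a..x}"
    by (simp add: cbox_interval image_affinity_atLeastAtMost)
  then have i: "(\<lambda>z. f (z + (y - x))) integrable_on {x-a..x}"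
    and eq: "integral {y-a..y} f = integral {x-a..x} (\<lambda>z. f (z + (y-x)))"
    by (auto simp: integral_unique)
  note eq
  also have "integral {x-a..x} (\<lambda>z. f (z + (y-x))) \<le> integral {x-a..x} f"
    by (intro integral_le i antimono_integrable f) (use f xy in \<open>auto simp: antimono_def\<close>)
  finally show "avg a f y \<le> avg a f x"
    using a by (simp add: avg_def divide_right_mono)
qed

text \<open>
  A fixed lower limit \<open>p\<close> exhibits the average as a difference quotient of an indefinite integral,
  to which the continuity and differentiability theorems for integrals apply.
\<close>

lemma avg_eq_indefinite:
  assumes "antimono f" "p \<le> x - a" "a \<ge> 0"
  shows "avg a f x = (integral {p..x} f - integral {p..x - a} f) / a"
  using Henstock_Kurzweil_Integration.integral_combine[of p "x - a" x f] antimono_integrable[OF assms(1)] assms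
  by (simp add: avg_def)

lemma avg_continuous:
  assumes a: "a > 0" and f: "antimono f"
  shows "isCont (avg a f) x"
proof -
  define p where "p = x - a - 1"
  let ?J = "\<lambda>x. integral {p..x} f"
  have J: "isCont ?J z" if "p < z" for z
  proof -
    have "continuous_on {p..z+1} ?J"
      by (rule indefinite_integral_continuous_1[OF antimono_integrable[OF f]])
    then have "continuous_on {p<..<z+1} ?J" by (rule continuous_on_subset) auto
    then show ?thesis using that by (simp add: continuous_on_eq_continuous_at)
  qed
  have "isCont (\<lambda>x. (?J x - ?J (x - a)) / a) x"
    using a by (intro continuous_intros J isCont_o2[where g="?J" and f="\<lambda>x. x - a"]) (auto simp: p_def)
  moreover have "\<forall>\<^sub>F z in nhds x. avg a f z = (?J z - ?J (z - a)) / a"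
    by (rule eventually_nhds_in_open[of "{x - 1<..}", THEN eventually_mono])
      (use a f in \<open>auto simp: p_def intro!: avg_eq_indefinite\<close>)
  ultimately show ?thesis by (simp add: isCont_cong)
qed

lemma avg_has_derivative:
  assumes a: "a > 0" and f: "antimono f" and cont: "\<And>x. isCont f x"
  shows "(avg a f has_real_derivative (f x - f (x - a)) / a) (at x)"
proof -
  define p where "p = x - a - 1"
  let ?J = "\<lambda>x. integral {p..x} f"
  have J: "(?J has_real_derivative f z) (at z)" if "p < z" for z
  proof -
    have "(?J has_real_derivative f z) (at z within {p..z+1})"
      by (rule integral_has_real_derivative) (use that cont in \<open>auto intro: continuous_at_imp_continuous_on\<close>)
    then show ?thesis using that by (simp add: at_within_Icc_at)
  qed
  have "((\<lambda>x. (?J x - ?J (x - a)) / a) has_real_derivative (f x - f (x - a)) / a) (at x)"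
    using a J[of x] J[of "x - a"] DERIV_shift[of ?J "f (x - a)" x "-a"]
    by (auto intro!: DERIV_cdivide DERIV_diff simp: p_def)
  moreover have "\<forall>\<^sub>F z in nhds x. avg a f z = (?J z - ?J (z - a)) / a"
    by (rule eventually_nhds_in_open[of "{x - 1<..}", THEN eventually_mono])
      (use a f in \<open>auto simp: p_def intro!: avg_eq_indefinite\<close>)
  ultimately show ?thesis by (simp add: DERIV_cong_ev)
qed

section \<open>The step function averaged over infinitely many windows\<close>

text \<open>
  The windows \<open>a n, \<dots>, a (n + N - 1)\<close> are applied with \<open>a n\<close> outermost. A further window thus
  enters innermost, and the recursion passes to the limit \<open>N \<rightarrow> \<infinity>\<close> as an equation between the
  limits for \<open>n\<close> and \<open>Suc n\<close>.
\<close>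

fun smoothed_step :: "(nat \<Rightarrow> real) \<Rightarrow> nat \<Rightarrow> nat \<Rightarrow> real \<Rightarrow> real" where
  "smoothed_step a n 0 = (\<lambda>x. if x \<le> 0 then 1 else 0)"
| "smoothed_step a n (Suc N) = avg (a n) (smoothed_step a (Suc n) N)"

context
  fixes a :: "nat \<Rightarrow> real"
  assumes a_pos: "\<And>n. a n > 0"
begin

lemma smoothed_step_antimono: "antimono (smoothed_step a n N)"
proof (induction N arbitrary: n)
  case 0
  show ?case by (auto intro: antimonoI)
next
  case (Suc N)
  then show ?case using a_pos by (simp add: avg_antimono)
qed

lemma smoothed_step_left: "x \<le> 0 \<Longrightarrow> smoothed_step a n N x = 1"
  by (induction N arbitrary: n x) (auto intro!: avg_const a_pos)

lemma smoothed_step_right: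
  "x > (\<Sum>j<N. a (n + j)) \<Longrightarrow> smoothed_step a n N x = 0"
proof (induction N arbitrary: n x)
  case (Suc N)
  have "(\<Sum>j<Suc N. a (n + j)) = a n + (\<Sum>j<N. a (Suc n + j))"
    by (subst sum.lessThan_Suc_shift) simp
  with Suc show ?case by (auto intro!: avg_const a_pos)
qed auto

lemma smoothed_step_range: "smoothed_step a n N x \<in> {0..1}"
proof -
  let ?y = "max (max x 0) ((\<Sum>j<N. a (n + j)) + 1)"
  have "smoothed_step a n N ?y = 0"
    by (rule smoothed_step_right) auto
  moreover have "smoothed_step a n N ?y \<le> smoothed_step a n N x"
    by (rule antimonoD[OF smoothed_step_antimono]) auto
  moreover have "smoothed_step a n N x \<le> smoothed_step a n N (min x 0)"
    by (rule antimonoD[OF smoothed_step_antimono]) auto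
  moreover have "smoothed_step a n N (min x 0) = 1" by (rule smoothed_step_left) auto
  ultimately show ?thesis by simp
qed

text \<open>
  The innermost new window raises the step function, since the average over a window to the left
  of a point dominates the value of a decreasing function there; averaging preserves this order.
\<close>

lemma smoothed_step_le_Suc: "smoothed_step a n N x \<le> smoothed_step a n (Suc N) x"
proof (induction N arbitrary: n x)
  case 0
  show ?case
    using smoothed_step_range[of n 1 x] smoothed_step_left[of x n 1] by (cases "x \<le> 0") auto
next
  case (Suc N)
  have "avg (a n) (smoothed_step a (Suc n) N) x \<le> avg (a n) (smoothed_step a (Suc n) (Suc N)) x"
    by (intro avg_mono a_pos smoothed_step_antimono Suc)
  then show ?case by simp
qed

definition limit_step :: "nat \<Rightarrow> real \<Rightarrow> real" where
  "limit_step n x = lim (\<lambda>N. smoothed_step a n N x)"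

lemma limit_step: "(\<lambda>N. smoothed_step a n N x) \<longlonglongrightarrow> limit_step n x"
proof -
  have "incseq (\<lambda>N. smoothed_step a n N x)"
    by (rule incseq_SucI) (rule smoothed_step_le_Suc)
  moreover have "\<forall>N. smoothed_step a n N x \<le> 1"
    using smoothed_step_range by auto
  ultimately have "convergent (\<lambda>N. smoothed_step a n N x)"
    by (meson incseq_convergent convergentI)
  then show ?thesis by (simp add: limit_step_def convergent_LIMSEQ_iff)
qed

lemma limit_step_antimono: "antimono (limit_step n)"
  by (rule antimonoI, rule LIMSEQ_le[OF limit_step limit_step])
    (use smoothed_step_antimono in \<open>auto simp: antimono_def\<close>)

lemma limit_step_range: "limit_step n x \<in> {0..1}"
proof -
  have "limit_step n x \<le> 1"
    by (rule LIMSEQ_le_const2[OF limit_step]) (use smoothed_step_range in auto)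
  moreover have "0 \<le> limit_step n x"
    by (rule LIMSEQ_le_const[OF limit_step]) (use smoothed_step_range in auto)
  ultimately show ?thesis by simp
qed

lemma limit_step_left: "x \<le> 0 \<Longrightarrow> limit_step n x = 1"
  using limit_step[of n x] smoothed_step_left[of x n] by (simp add: LIMSEQ_const_iff)

lemma limit_step_right:
  assumes "\<And>N. (\<Sum>j<N. a (n + j)) < x"
  shows "limit_step n x = 0"
  using limit_step[of n x] smoothed_step_right[OF assms] by (simp add: LIMSEQ_const_iff)

text \<open>
  Monotone convergence under the integral of the outermost average.
\<close>

lemma limit_step_avg: "limit_step n = avg (a n) (limit_step (Suc n))"
proof
  fix x
  let ?S = "{x - a n..x}"
  have b: "integral ?S (smoothed_step a (Suc n) N) \<in> {0..a n}" for N
  proof -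
    have "smoothed_step a n (Suc N) x \<in> {0..1}" by (rule smoothed_step_range)
    then show ?thesis using a_pos[of n] by (simp add: avg_def field_simps)
  qed
  have "bounded {0..a n}" by simp
  then have bd: "bounded (range (\<lambda>N. integral ?S (smoothed_step a (Suc n) N)))"
    by (rule bounded_subset) (use b in auto)
  have "(\<lambda>N. integral ?S (smoothed_step a (Suc n) N)) \<longlonglongrightarrow> integral ?S (limit_step (Suc n))"
    by (rule conjunct2[OF monotone_convergence_increasing])
      (auto intro: antimono_integrable smoothed_step_antimono smoothed_step_le_Suc limit_step bd
        simp del: smoothed_step.simps)
  then have "(\<lambda>N. smoothed_step a n (Suc N) x) \<longlonglongrightarrow> avg (a n) (limit_step (Suc n)) x"
    using a_pos[of n] by (auto simp: avg_def intro!: tendsto_divide)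
  moreover have "(\<lambda>N. smoothed_step a n (Suc N) x) \<longlonglongrightarrow> limit_step n x"
    using limit_step by (rule LIMSEQ_Suc)
  ultimately show "limit_step n x = avg (a n) (limit_step (Suc n)) x"
    using LIMSEQ_unique by blast
qed

text \<open>
  The derivative of \<open>avg a f\<close> is the difference quotient \<open>(f x - f (x - a)) / a\<close>. Iterating this
  along the equations \<open>limit_step n = avg (a n) (limit_step (Suc n))\<close> expresses each derivative
  by values of \<open>limit_step\<close> itself.
\<close>

fun step_tower :: "nat \<Rightarrow> nat \<Rightarrow> real \<Rightarrow> real" where
  "step_tower n 0 x = limit_step n x"
| "step_tower n (Suc k) x = (step_tower (Suc n) k x - step_tower (Suc n) k (x - a n)) / a n"

lemma limit_step_continuous: "isCont (limit_step n) x"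
  by (subst limit_step_avg) (rule avg_continuous[OF a_pos limit_step_antimono])

lemma derivative_tower_step_tower: "derivative_tower (step_tower n)"
proof -
  have "(step_tower n k has_real_derivative step_tower n (Suc k) x) (at x)" for n k x
  proof (induction k arbitrary: n x)
    case 0
    have "step_tower n 0 = avg (a n) (limit_step (Suc n))"
      by (metis limit_step_avg step_tower.simps(1) ext)
    then show ?case
      using avg_has_derivative[OF a_pos limit_step_antimono limit_step_continuous, of n "Suc n" x] by simp
  next
    case (Suc k)
    have "((\<lambda>x. (step_tower (Suc n) k x - step_tower (Suc n) k (x - a n)) / a n)
      has_real_derivative (step_tower (Suc n) (Suc k) x - step_tower (Suc n) (Suc k) (x - a n)) / a n) (at x)"
      using Suc[of "Suc n" x] Suc[of "Suc n" "x - a n"]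
        DERIV_shift[of "step_tower (Suc n) k" _ x "- a n"]
      by (intro DERIV_cdivide DERIV_diff) auto
    then show ?case by (simp del: step_tower.simps(2) add: step_tower.simps(2)[abs_def])
  qed
  then show ?thesis by (simp add: derivative_tower_def)
qed

text \<open>
  Each difference quotient costs \<open>2 / a (n + j)\<close>, except the last one reached, which acts on a
  function with values in \<open>[0,1]\<close> and costs \<open>1 / a (n + k)\<close>.
\<close>

lemma step_tower_bound: "\<bar>step_tower n (Suc k) x\<bar> \<le> 2 ^ k / (\<Prod>j\<le>k. a (n + j))"
proof (induction k arbitrary: n x)
  case 0
  have "\<bar>limit_step (Suc n) x - limit_step (Suc n) (x - a n)\<bar> \<le> 1"
    using limit_step_range[of "Suc n" x] limit_step_range[of "Suc n" "x - a n"] by auto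
  then show ?case using a_pos[of n] by (simp add: divide_right_mono)
next
  case (Suc k)
  let ?B = "2 ^ k / (\<Prod>j\<le>k. a (Suc n + j))"
  have "\<bar>step_tower (Suc n) (Suc k) x - step_tower (Suc n) (Suc k) (x - a n)\<bar> \<le> 2 * ?B"
    using Suc.IH[of "Suc n" x] Suc.IH[of "Suc n" "x - a n"] by linarith
  then have "\<bar>step_tower (Suc n) (Suc k) x - step_tower (Suc n) (Suc k) (x - a n)\<bar> / a n \<le> 2 * ?B / a n"
    using a_pos[of n] by (intro divide_right_mono) auto
  then have "\<bar>step_tower n (Suc (Suc k)) x\<bar> \<le> 2 * ?B / a n"
    using a_pos[of n] by (subst step_tower.simps(2)) (simp add: abs_divide del: step_tower.simps)
  also have "\<dots> = 2 ^ Suc k / (\<Prod>j\<le>Suc k. a (n + j))"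
    by (subst prod.atMost_Suc_shift) (simp add: mult_ac)
  finally show ?case .
qed

end

section \<open>The choice of the windows\<close>

lemma sum_le_set_integral:
  fixes g :: "real \<Rightarrow> real"
  assumes int: "set_integrable lborel {0..} g"
    and anti: "\<And>x y. 0 \<le> x \<Longrightarrow> x \<le> y \<Longrightarrow> g y \<le> g x"
    and nonneg: "\<And>x. 0 \<le> x \<Longrightarrow> 0 \<le> g x"
  shows "(\<Sum>j<N. g (real j + 1)) \<le> (LBINT t:{0..}. g t)"
proof -
  have int': "set_integrable lborel {u..<v} g" if "u \<ge> 0" for u v :: real
    by (rule set_integrable_subset[OF int]) (use that in auto)
  have "(\<Sum>j<N. g (real j + 1)) \<le> (LBINT t:{0..<real N}. g t)"
  proof (induction N)
    case (Suc N)
    have "g (real N + 1) = (LBINT t:{real N..<real N + 1}. g (real N + 1))"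
      by (simp add: set_lebesgue_integral_def)
    also have "\<dots> \<le> (LBINT t:{real N..<real N + 1}. g t)"
    proof (rule set_integral_mono)
      show "set_integrable lborel {real N..<real N + 1} (\<lambda>_. g (real N + 1))"
        by (simp add: set_integrable_def)
    qed (auto intro: anti int')
    finally have "(\<Sum>j<Suc N. g (real j + 1))
        \<le> (LBINT t:{0..<real N}. g t) + (LBINT t:{real N..<real N + 1}. g t)"
      using Suc by simp
    also have "\<dots> = (LBINT t:{0..<real N} \<union> {real N..<real N + 1}. g t)"
      by (rule set_integral_Un[symmetric]) (auto intro: int')
    also have "{0..<real N} \<union> {real N..<real N + 1} = {0..<real (Suc N)}"
      by auto
    finally show ?case .
  qed (simp add: set_lebesgue_integral_def)
  also have "\<dots> \<le> (LBINT t:{0..}. g t)"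
    unfolding set_lebesgue_integral_def
    by (rule integral_mono)
      (use int int'[of 0 "real N"] nonneg in \<open>auto simp: set_integrable_def indicator_def\<close>)
  finally show ?thesis .
qed

lemma prod_real_Suc: "(\<Prod>j\<le>k. real j + 1) = fact (Suc k)"
  by (induction k) (auto simp: algebra_simps)

text \<open>
  The windows \<open>1 / (M (j + 1) L j)\<close> turn the product in \<open>step_tower_bound\<close> into the factorial times
  powers of \<open>M\<close> and \<open>L\<close>, and \<open>M\<close> is just large enough for their total length to be at most \<open>1\<close>.
\<close>

lemma smooth_cutoff_exists:
  fixes L :: "real \<Rightarrow> real" and M :: real
  assumes L1: "\<And>t. t \<ge> 0 \<Longrightarrow> L t \<ge> 1"
    and mono: "mono_on {0..} L"
    and L0: "L 0 = 1"
    and int: "set_integrable lborel {0..} (\<lambda>t. 1 / ((t + 1) * L t))"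
    and M: "M = 1 + (LBINT t:{0..}. 1 / ((t + 1) * L t))"
  obtains f where "derivative_tower f" "\<And>t. f 0 t \<in> {0..1}"
    "\<And>t. t \<le> 1 \<Longrightarrow> f 0 t = 1" "\<And>t. t \<ge> 2 \<Longrightarrow> f 0 t = 0"
    "\<And>k t. k \<ge> 1 \<Longrightarrow> \<bar>f k t\<bar> \<le> fact k * (2 * M * L (real k - 1)) ^ k"
proof -
  let ?g = "\<lambda>t. 1 / ((t + 1) * L t)"
  have Lmono: "L x \<le> L y" if "0 \<le> x" "x \<le> y" for x y
    using mono that by (auto simp: mono_on_def)
  have Lpos: "L t > 0" if "t \<ge> 0" for t using L1[OF that] by simp
  have sum_g: "(\<Sum>j<N. ?g (real j + 1)) \<le> (LBINT t:{0..}. ?g t)" for N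
  proof (rule sum_le_set_integral[OF int])
    show "?g y \<le> ?g x" if "0 \<le> x" "x \<le> y" for x y
      using that Lpos[of x] Lpos[of y] Lmono[of x y] by (intro divide_left_mono mult_mono) auto
    show "0 \<le> ?g x" if "0 \<le> x" for x using that Lpos[of x] by simp
  qed
  have M1: "M \<ge> 1" using sum_g[of 0] M by simp
  define a where "a = (\<lambda>j::nat. 1 / (M * ((real j + 1) * L (real j))))"
  have a_pos: "a j > 0" for j using M1 Lpos[of "real j"] by (simp add: a_def)
  have sum_le: "(\<Sum>j<N. a j) \<le> 1" for N
  proof -
    have "(\<Sum>j<N. a j) \<le> (\<Sum>j<Suc N. a j)" using a_pos[of N] by simp
    \<comment> \<open>as \<open>L 0 = 1\<close>, the first window is \<open>1 / M\<close>; this is the summand \<open>1\<close> of \<open>M\<close>\<close>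
    also have "\<dots> = a 0 + (\<Sum>j<N. a (Suc j))" by (rule sum.lessThan_Suc_shift)
    also have "\<dots> = (1 + (\<Sum>j<N. ?g (real j + 1))) / M"
      by (simp add: a_def L0 add_divide_distrib sum_divide_distrib mult_ac add_ac)
    also have "\<dots> \<le> 1" using sum_g[of N] M1 M by simp
    finally show ?thesis .
  qed
  \<comment> \<open>strict for every finite sum, hence the limit vanishes at the endpoint \<open>1\<close> too\<close>
  have sum_less: "(\<Sum>j<N. a (0 + j)) < 1" for N
    using sum_le[of "Suc N"] a_pos[of N] by simp
  \<comment> \<open>the shift by \<open>1\<close>, written in the form of \<open>tower_affine\<close>\<close>
  define f where "f = (\<lambda>k t. 1 ^ k * step_tower a 0 k (1 * t + -1))"
  have f0: "f 0 t = limit_step a 0 (t - 1)" for t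
    using step_tower.simps[where a = a, OF a_pos] by (simp add: f_def)
  show ?thesis
  proof (rule that)
    show "derivative_tower f"
      unfolding f_def by (rule tower_affine[OF derivative_tower_step_tower[where a = a, OF a_pos]])
    show "f 0 t \<in> {0..1}" for t
      unfolding f0 by (rule limit_step_range[where a = a, OF a_pos])
    show "f 0 t = 1" if "t \<le> 1" for t
      unfolding f0 by (rule limit_step_left[where a = a, OF a_pos]) (use that in auto)
    show "f 0 t = 0" if "t \<ge> 2" for t
      unfolding f0 by (rule limit_step_right[where a = a, OF a_pos]) (rule less_le_trans[OF sum_less], use that in auto)
    show "\<bar>f k t\<bar> \<le> fact k * (2 * M * L (real k - 1)) ^ k" if k: "k \<ge> 1" for k t
    proof -
      obtain m where m: "k = Suc m" using k by (cases k) auto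
      have "\<bar>f k t\<bar> \<le> 2 ^ m / (\<Prod>j\<le>m. a (0 + j))"
        using step_tower_bound[where a = a, OF a_pos, of 0 m "t - 1"] by (simp add: f_def m)
      also have "\<dots> = 2 ^ m * (\<Prod>j\<le>m. M * ((real j + 1) * L (real j)))"
        by (simp add: a_def prod_dividef)
      also have "(\<Prod>j\<le>m. M * ((real j + 1) * L (real j))) \<le> (\<Prod>j\<le>m. M * ((real j + 1) * L (real m)))"
        using M1 Lpos Lmono by (intro prod_mono conjI mult_left_mono mult_nonneg_nonneg) (auto intro: less_imp_le)
      also have "\<dots> = fact k * (M * L (real m)) ^ k"
        by (simp add: prod.distrib prod_real_Suc m power_mult_distrib mult_ac del: fact_Suc)
      also have "2 ^ m * (fact k * (M * L (real m)) ^ k) \<le> 2 ^ k * (fact k * (M * L (real m)) ^ k)"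
        using M1 Lpos[of m] by (intro mult_right_mono) (auto simp: m)
      also have "\<dots> = fact k * (2 * M * L (real k - 1)) ^ k"
        by (simp add: m power_mult_distrib mult_ac)
      finally show ?thesis by simp
    qed
  qed
qed

section \<open>Difference of two dyadic dilates\<close>

text \<open>
  To the left of \<open>1\<close> the first term is constant, to the right of \<open>1\<close> the second. Adding the bounds
  of the two terms instead would give a factor \<open>3/2\<close> at order \<open>1\<close>, and \<open>\<pi>/2\<close> times this exceeds the
  constant \<open>2\<close> that \<open>cis_tower_bound\<close> can absorb.
\<close>

lemma dyadic_difference_bound:
  assumes f: "derivative_tower f"
    and one: "\<And>t. t \<le> 1 \<Longrightarrow> f 0 t = 1" and zero: "\<And>t. t \<ge> 2 \<Longrightarrow> f 0 t = 0"
    and b: "\<And>t. \<bar>f k t\<bar> \<le> fact k * B ^ k" and k: "k \<ge> 1" and B: "B \<ge> 0"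
  shows "\<bar>f k t - 2 ^ k * f k (2 * t)\<bar> \<le> fact k * (2 * B) ^ k"
proof (cases "t \<le> 1")
  case True
  then have "f k t = 0"
    using tower_zero_if_constant_left[where g = f and x = 1 and c = 1 and k = k and t = t] f one k by simp
  then show ?thesis
    using b[of "2 * t"] by (simp add: abs_mult power_mult_distrib mult.left_commute)
next
  case False
  then have "f k (2 * t) = 0"
    using tower_zero_if_constant_right[where g = f and x = 2 and c = 0 and k = k and t = "2 * t"] f zero k by simp
  moreover have "fact k * B ^ k \<le> fact k * (2 * B) ^ k"
    using B by (intro mult_left_mono power_mono) auto
  ultimately show ?thesis using b[of t] by (metis diff_zero mult_zero_right order_trans)
qed

section \<open>Derivatives of the exponential of an imaginary phase\<close>

text \<open>
  With \<open>E = exp (i \<theta>)\<close>, this is the Leibniz rule for the derivatives of \<open>E' = i \<theta>' E\<close>. Treating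
  sine and cosine as one complex function makes the recursion refer to a single sequence.
\<close>

fun cis_tower :: "(nat \<Rightarrow> real \<Rightarrow> real) \<Rightarrow> nat \<Rightarrow> real \<Rightarrow> complex" where
  "cis_tower \<theta> 0 t = cis (\<theta> 0 t)"
| "cis_tower \<theta> (Suc k) t =
     (\<Sum>j\<le>k. real (k choose j) *\<^sub>R (\<theta> (Suc j) t *\<^sub>R (\<i> * cis_tower \<theta> (k - j) t)))"

text \<open>
  The inductive step of the Leibniz rule, with \<open>p i j\<close> for the product of the \<open>i\<close>-th derivative of
  one factor and the \<open>j\<close>-th of the other.
\<close>

lemma Leibniz_step:
  fixes p :: "nat \<Rightarrow> nat \<Rightarrow> 'a::real_vector"
  shows "(\<Sum>j\<le>k. real (k choose j) *\<^sub>R (p j (Suc (k - j)) + p (Suc j) (k - j)))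
       = (\<Sum>j\<le>Suc k. real (Suc k choose j) *\<^sub>R p j (Suc k - j))"
proof -
  have "(\<Sum>j\<le>k. real (k choose j) *\<^sub>R p j (Suc (k - j))) = (\<Sum>j\<le>k. real (k choose j) *\<^sub>R p j (Suc k - j))"
    by (intro sum.cong) (auto simp: Suc_diff_le)
  also have "\<dots> = (\<Sum>j\<le>Suc k. real (k choose j) *\<^sub>R p j (Suc k - j))"
    by (simp add: binomial_eq_0)
  also have "\<dots> = p 0 (Suc k) + (\<Sum>j\<le>k. real (k choose Suc j) *\<^sub>R p (Suc j) (k - j))"
    by (subst sum.atMost_Suc_shift) simp
  finally show ?thesis
    by (subst sum.atMost_Suc_shift) (simp add: scaleR_add_left scaleR_add_right sum.distrib)
qed

lemma cis_tower_has_vector_derivative: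
  assumes \<theta>: "derivative_tower \<theta>"
  shows "(cis_tower \<theta> k has_vector_derivative cis_tower \<theta> (Suc k) t) (at t)"
proof (induction k arbitrary: t rule: less_induct)
  case (less k)
  have d\<theta>: "(\<theta> j has_real_derivative \<theta> (Suc j) t) (at t)" for j t
    using \<theta> by (simp add: derivative_tower_def)
  show ?case
  proof (cases k)
    case 0
    have "((\<lambda>t. \<i> * of_real (\<theta> 0 t)) has_vector_derivative \<i> * of_real (\<theta> 1 t)) (at t)"
      using d\<theta>[of 0 t] by (auto intro!: has_vector_derivative_mult_right has_vector_derivative_of_real)
    from field_vector_diff_chain_at[OF this DERIV_exp]
    show ?thesis by (simp add: 0 cis_conv_exp o_def scaleR_conv_of_real mult_ac)
  next
    case (Suc m)
    have "((\<lambda>t. real (m choose j) *\<^sub>R (\<theta> (Suc j) t *\<^sub>R (\<i> * cis_tower \<theta> (m - j) t))) has_vector_derivative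
      real (m choose j) *\<^sub>R (\<theta> (Suc j) t *\<^sub>R (\<i> * cis_tower \<theta> (Suc (m - j)) t)
         + \<theta> (Suc (Suc j)) t *\<^sub>R (\<i> * cis_tower \<theta> (m - j) t))) (at t)" if "j \<le> m" for j
    proof -
      have "(cis_tower \<theta> (m - j) has_vector_derivative cis_tower \<theta> (Suc (m - j)) t) (at t)"
        by (rule less.IH) (use Suc in auto)
      then have "((\<lambda>t. \<i> * cis_tower \<theta> (m - j) t) has_vector_derivative \<i> * cis_tower \<theta> (Suc (m - j)) t) (at t)"
        by (rule has_vector_derivative_mult_right)
      from has_vector_derivative_scaleR[OF d\<theta> this, of "Suc j"]
      show ?thesis
        by (rule bounded_linear.has_vector_derivative[OF bounded_linear_scaleR_right])
    qed
    then have "((\<lambda>t. \<Sum>j\<le>m. real (m choose j) *\<^sub>R (\<theta> (Suc j) t *\<^sub>R (\<i> * cis_tower \<theta> (m - j) t))) has_vector_derivative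
      (\<Sum>j\<le>m. real (m choose j) *\<^sub>R (\<theta> (Suc j) t *\<^sub>R (\<i> * cis_tower \<theta> (Suc (m - j)) t)
         + \<theta> (Suc (Suc j)) t *\<^sub>R (\<i> * cis_tower \<theta> (m - j) t)))) (at t)"
      by (intro has_vector_derivative_sum) auto
    also have "(\<Sum>j\<le>m. real (m choose j) *\<^sub>R (\<theta> (Suc j) t *\<^sub>R (\<i> * cis_tower \<theta> (Suc (m - j)) t)
         + \<theta> (Suc (Suc j)) t *\<^sub>R (\<i> * cis_tower \<theta> (m - j) t))) = cis_tower \<theta> (Suc k) t"
      unfolding Suc cis_tower.simps(2)[of _ "Suc m"]
      by (rule Leibniz_step[of m "\<lambda>i j. \<theta> (Suc i) t *\<^sub>R (\<i> * cis_tower \<theta> j t)"])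
    finally show ?thesis by (simp only: Suc cis_tower.simps(2)[abs_def])
  qed
qed

lemma sum_Suc_power2: "(\<Sum>j\<le>k. (real j + 1) * 2 ^ (k - j)) = 2 ^ (k + 2) - real k - 3"
proof (induction k)
  case (Suc k)
  have "(\<Sum>j\<le>k. (real j + 1) * 2 ^ (Suc k - j)) = 2 * (\<Sum>j\<le>k. (real j + 1) * 2 ^ (k - j))"
    unfolding sum_distrib_left by (intro sum.cong) (auto simp: Suc_diff_le)
  then show ?case using Suc by simp
qed simp

lemma sum_Suc_power2_le: "2 * (\<Sum>j\<le>k. (real j + 1) * 2 ^ (k - j)) \<le> (real k + 1) * 2 ^ Suc k"
proof (cases "k \<ge> 3")
  case True
  have "2 * (2 ^ (k + 2) - real k - 3) \<le> 4 * (2::real) ^ Suc k" by simp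
  also have "\<dots> \<le> (real k + 1) * 2 ^ Suc k" using True by (intro mult_right_mono) auto
  finally show ?thesis by (simp only: sum_Suc_power2)
next
  case False
  then have "k = 0 \<or> k = 1 \<or> k = 2" by auto
  then show ?thesis unfolding sum_Suc_power2 by auto
qed

text \<open>
  Write the bound on the phase as \<open>c R\<^sup>j\<close> on normalized derivatives, with \<open>c = 2\<close>. The recursion
  reproduces the geometric bound \<open>(2R)\<^sup>k\<close> exactly if
  \<open>c \<Sum>\<^sub>j\<^sub>\<le>\<^sub>k (j + 1) 2\<^bsup>k - j\<^esup> \<le> (k + 1) 2\<^bsup>k + 1\<^esup>\<close>, which holds for
  all \<open>k\<close> when \<open>c = 2\<close>, with equality at \<open>k = 0\<close> and \<open>k = 1\<close>. The hypothesis covers the orders up to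
  \<open>K\<close> only, because \<open>R\<close> will depend on \<open>K\<close>.
\<close>

lemma cis_tower_bound:
  assumes \<theta>: "\<And>j. 1 \<le> j \<Longrightarrow> j \<le> K \<Longrightarrow> \<bar>\<theta> j t\<bar> \<le> 2 * (fact j * R ^ j)" and R: "R \<ge> 0"
    and "k \<le> K"
  shows "norm (cis_tower \<theta> k t) \<le> fact k * (2 * R) ^ k"
  using \<open>k \<le> K\<close>
proof (induction k rule: less_induct)
  case (less k)
  show ?case
  proof (cases k)
    case (Suc m)
    have "norm (cis_tower \<theta> k t)
        \<le> (\<Sum>j\<le>m. real (m choose j) * (\<bar>\<theta> (Suc j) t\<bar> * norm (cis_tower \<theta> (m - j) t)))"
      unfolding Suc cis_tower.simps(2)
      by (rule order_trans[OF norm_sum]) (simp add: norm_mult abs_mult mult.assoc)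
    also have "\<dots> \<le> (\<Sum>j\<le>m. real (m choose j) *
        ((2 * (fact (Suc j) * R ^ Suc j)) * (fact (m - j) * (2 * R) ^ (m - j))))"
      using R by (intro sum_mono mult_left_mono mult_mono less.IH \<theta>) (use less.prems Suc in auto)
    also have "\<dots> = (\<Sum>j\<le>m. fact m * R ^ Suc m * 2 * ((real j + 1) * 2 ^ (m - j)))"
    proof (rule sum.cong)
      fix j assume "j \<in> {..m}"
      then have j: "j \<le> m" by simp
      have A: "real (m choose j) * fact j * fact (m - j) = fact m"
        using arg_cong[OF binomial_fact_lemma[OF j], of real] by (simp add: mult_ac)
      have B: "R ^ Suc j * R ^ (m - j) = R ^ Suc m"
        using j by (simp flip: power_add)
      have "fact (Suc j) = (real j + 1) * fact j" by (simp add: algebra_simps)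
      then have "real (m choose j) *
          ((2 * (fact (Suc j) * R ^ Suc j)) * (fact (m - j) * (2 * R) ^ (m - j)))
        = (real (m choose j) * fact j * fact (m - j)) * (R ^ Suc j * R ^ (m - j)) * 2 * ((real j + 1) * 2 ^ (m - j))"
        by (simp only: power_mult_distrib mult_ac)
      then show "real (m choose j) *
          ((2 * (fact (Suc j) * R ^ Suc j)) * (fact (m - j) * (2 * R) ^ (m - j)))
        = fact m * R ^ Suc m * 2 * ((real j + 1) * 2 ^ (m - j))" by (simp only: A B)
    qed simp
    also have "\<dots> = fact m * R ^ Suc m * (2 * (\<Sum>j\<le>m. (real j + 1) * 2 ^ (m - j)))"
      by (simp add: sum_distrib_left mult_ac)
    also have "\<dots> \<le> fact m * R ^ Suc m * ((real m + 1) * 2 ^ Suc m)"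
      by (intro mult_left_mono sum_Suc_power2_le) (use R in auto)
    also have "\<dots> = fact k * (2 * R) ^ k"
      by (simp add: Suc power_mult_distrib algebra_simps)
    finally show ?thesis .
  qed simp
qed

section \<open>The dyadic partition of unity and the cutoff functions\<close>

text \<open>
  For \<open>2\<^sup>n \<le> t < 2\<^bsup>n + 1\<^esup>\<close> only the indices \<open>n\<close> and \<open>n + 1\<close> contribute. With \<open>s = t / 2\<^sup>n\<close> their
  terms are \<open>sin\<^sup>2\<close> and \<open>cos\<^sup>2\<close> of \<open>\<pi>/2 \<phi>(s)\<close>, because \<open>\<phi>(2s) = 0\<close> and \<open>\<phi>(s/2) = 1\<close>.
\<close>

lemma dyadic_sum_of_squares:
  fixes \<phi> :: "real \<Rightarrow> real"
  assumes one: "\<And>t. t \<le> 1 \<Longrightarrow> \<phi> t = 1" and zero: "\<And>t. t \<ge> 2 \<Longrightarrow> \<phi> t = 0" and t: "t \<ge> 1"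
  defines "a \<equiv> \<lambda>t. sin (pi / 2 * (\<phi> t - \<phi> (2 * t)))"
  shows "(\<lambda>j::nat. \<bar>a (2 powi (- int j) * t)\<bar>\<^sup>2) sums 1"
proof -
  obtain n where n: "2 ^ n \<le> t" "t < 2 ^ Suc n"
  proof -
    have ex: "\<exists>m. t < 2 ^ m" using real_arch_pow[of 2 t] by simp
    define m where "m = (LEAST m. t < 2 ^ m)"
    have m: "t < 2 ^ m" unfolding m_def by (rule LeastI_ex[OF ex])
    with t obtain n where n: "m = Suc n" by (cases m) auto
    have "\<not> t < 2 ^ n" by (rule not_less_Least) (simp flip: m_def add: n)
    then show ?thesis using that[of n] m n by simp
  qed
  have e: "2 powi (- int j) * t = t / 2 ^ j" for j
    by (simp add: power_int_minus divide_inverse mult.commute)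
  have "a (t / 2 ^ j) = 0" if "j \<notin> {n, Suc n}" for j
  proof (cases "j < n")
    case True
    then have "(2::real) ^ Suc j \<le> 2 ^ n" by (intro power_increasing) auto
    then have "t / 2 ^ j \<ge> 2" using n by (simp add: field_simps)
    then show ?thesis by (simp add: a_def zero)
  next
    case False
    then have "(2::real) ^ Suc (Suc n) \<le> 2 ^ j" using that by (intro power_increasing) auto
    then have "2 * (t / 2 ^ j) \<le> 1" using n by (simp add: field_simps)
    moreover have "t / 2 ^ j \<ge> 0" using t by simp
    ultimately have "t / 2 ^ j \<le> 1" "2 * (t / 2 ^ j) \<le> 1" by linarith+
    then have "\<phi> (t / 2 ^ j) = 1" "\<phi> (2 * (t / 2 ^ j)) = 1" by (intro one; simp)+
    then show ?thesis by (simp add: a_def)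
  qed
  then have "(\<lambda>j::nat. \<bar>a (2 powi (- int j) * t)\<bar>\<^sup>2) sums (\<Sum>j\<in>{n, Suc n}. \<bar>a (2 powi (- int j) * t)\<bar>\<^sup>2)"
    by (intro sums_finite) (auto simp: e)
  also have "(\<Sum>j\<in>{n, Suc n}. \<bar>a (2 powi (- int j) * t)\<bar>\<^sup>2) = (a (t / 2 ^ n))\<^sup>2 + (a (t / 2 ^ n / 2))\<^sup>2"
    unfolding e by (simp add: mult.commute)
  also have "\<dots> = 1"
  proof -
    define s where "s = t / 2 ^ n"
    have s: "1 \<le> s" "s < 2" using n by (simp_all add: s_def field_simps)
    have "a s = sin (pi / 2 * \<phi> s)" using s by (simp add: a_def zero)
    moreover have "a (s / 2) = sin (pi / 2 - pi / 2 * \<phi> s)" using s by (simp add: a_def one algebra_simps)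
    then have "a (s / 2) = cos (pi / 2 * \<phi> s)" by (simp add: sin_diff)
    ultimately show ?thesis by (simp flip: s_def)
  qed
  finally show ?thesis .
qed

theorem theorem2p3:
  fixes L :: "real \<Rightarrow> real" and M :: real
  assumes "\<And>t. t \<ge> 0 \<Longrightarrow> L t \<ge> 1"
    and "mono_on {0..} L"
    and "L 0 = 1"
    and "set_integrable lborel {0..} (\<lambda>t. 1 / ((t + 1) * L t))"
    and "M = 1 + (LBINT t:{0..}. 1 / ((t + 1) * L t))"
  shows "(\<exists>a \<in> S_one L 1 (2 * M). admissible_a a \<and> a ` {0..} \<subseteq> {0..1}) \<and>
         (\<exists>a \<in> S_one L 2 (4 * M). admissible_b a \<and> a ` {0..} \<subseteq> {0..1}) \<and>
         (\<exists>a \<in> S_one L 8 (8 * M). admissible_c a \<and> a ` {0..} \<subseteq> {0..1})"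
proof -
  obtain f where f: "derivative_tower f" and range: "\<And>t. f 0 t \<in> {0..1}"
    and one: "\<And>t. t \<le> 1 \<Longrightarrow> f 0 t = 1" and zero: "\<And>t. t \<ge> 2 \<Longrightarrow> f 0 t = 0"
    and bound: "\<And>k t. k \<ge> 1 \<Longrightarrow> \<bar>f k t\<bar> \<le> fact k * (2 * M * L (real k - 1)) ^ k"
    using smooth_cutoff_exists[OF assms] by metis
  have "(LBINT t:{0..}. 1 / ((t + 1) * L t)) \<ge> 0"
    unfolding set_lebesgue_integral_def
    by (rule Bochner_Integration.integral_nonneg) (use assms(1) in \<open>force simp: indicator_def intro: order_trans[OF zero_le_one]\<close>)
  then have M0: "M \<ge> 0" using assms(5) by simp
  have L0: "L t \<ge> 0" if "t \<ge> 0" for t using assms(1)[OF that] by simp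
  have f_left: "f k t = 0" if "k \<ge> 1" "t \<le> 1" for k t
    using tower_zero_if_constant_left[where g = f and x = 1 and c = 1] f one that by simp

  have a: "f 0 \<in> S_one L 1 (2 * M)" "admissible_a (f 0)" "f 0 ` {0..} \<subseteq> {0..1}"
  proof -
    show "f 0 \<in> S_one L 1 (2 * M)"
      by (rule tower_S_one[OF f]) (use range bound in \<open>auto simp: abs_le_iff intro: order_trans[of _ 0]\<close>)
    have "supp (f 0) \<subseteq> {0..2}"
      by (rule supp_subset) (meson zero linear)
    then have "admissible (f 0)"
      by (rule tower_admissible[OF f]) (simp add: f_left)
    then show "admissible_a (f 0)" by (simp add: admissible_a_def one)
    show "f 0 ` {0..} \<subseteq> {0..1}" using range by blast
  qed

  define g where "g = (\<lambda>k t. f k t - 2 ^ k * f k (2 * t + 0))"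
  have g: "derivative_tower g"
    unfolding g_def by (intro tower_diff f tower_affine)
  have g0: "g 0 t = f 0 t - f 0 (2 * t)" for t by (simp add: g_def)
  have g_range: "g 0 t \<in> {0..1}" for t
    using range[of t] range[of "2 * t"] one[of t] zero[of "2 * t"]
    by (cases "t \<le> 1") (auto simp: g0)
  have g_bound: "\<bar>g k t\<bar> \<le> fact k * (4 * M * L (real k - 1)) ^ k" if k: "k \<ge> 1" for k t
  proof -
    have "\<bar>g k t\<bar> \<le> fact k * (2 * (2 * M * L (real k - 1))) ^ k"
      unfolding g_def add_0_right
      by (rule dyadic_difference_bound[OF f one zero bound k]) (use k M0 L0 in auto)
    also have "2 * (2 * M * L (real k - 1)) = 4 * M * L (real k - 1)" by simp
    finally show ?thesis .
  qed
  have g_supp: "1/2 \<le> t \<and> t \<le> 2" if "t \<ge> 0" "g 0 t \<noteq> 0" for t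
  proof (rule ccontr)
    assume "\<not> ?thesis"
    then consider "2 * t \<le> 1" | "t \<ge> 2" by linarith
    then have "g 0 t = 0"
    proof cases
      case 1
      then show ?thesis using one[of t] one[of "2 * t"] \<open>t \<ge> 0\<close> by (simp add: g0)
    next
      case 2
      then show ?thesis using zero[of t] zero[of "2 * t"] by (simp add: g0)
    qed
    with that show False by simp
  qed
  have g_0: "g k 0 = 0" if "k \<ge> 1" for k
    using that by (simp add: g_def f_left)

  have b: "g 0 \<in> S_one L 2 (4 * M)" "admissible_b (g 0)" "g 0 ` {0..} \<subseteq> {0..1}"
  proof -
    show "g 0 \<in> S_one L 2 (4 * M)"
    proof (rule tower_S_one[OF g])
      show "\<bar>g 0 t\<bar> \<le> 2" for t using g_range[of t] by simp
      show "\<bar>g k t\<bar> \<le> fact k * (2 * (4 * M * L (real k - 1)) ^ k)" if "k \<ge> 1" for k t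
      proof -
        have "0 \<le> fact k * (4 * M * L (real k - 1)) ^ k" using M0 L0 that by simp
        then show ?thesis using g_bound[OF that, of t] by simp
      qed
    qed
    have s: "supp (g 0) \<subseteq> {1/2..2}" by (rule supp_subset) (rule g_supp)
    then have "admissible (g 0)"
      by (intro tower_admissible g g_0) auto
    then show "admissible_b (g 0)" using s by (simp add: admissible_b_def)
    show "g 0 ` {0..} \<subseteq> {0..1}" using g_range by blast
  qed

  define \<theta> where "\<theta> = (\<lambda>k t. pi / 2 * g k t)"
  have \<theta>: "derivative_tower \<theta>" unfolding \<theta>_def by (rule tower_cmult[OF g])
  define h where "h = (\<lambda>k t. Im (cis_tower \<theta> k t))"
  have h: "derivative_tower h"
    unfolding derivative_tower_def h_def has_real_derivative_iff_has_vector_derivative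
    by (intro allI bounded_linear.has_vector_derivative[OF bounded_linear_Im] cis_tower_has_vector_derivative \<theta>)
  have h0: "h 0 t = sin (pi / 2 * (f 0 t - f 0 (2 * t)))" for t
    by (simp add: h_def \<theta>_def g0)
  have h_range: "h 0 t \<in> {0..1}" for t
  proof -
    have "0 \<le> pi / 2 * g 0 t" "pi / 2 * g 0 t \<le> pi / 2 * 1"
      using g_range[of t] by (auto intro!: mult_left_mono)
    then have "0 \<le> sin (pi / 2 * g 0 t)" by (intro sin_ge_zero) auto
    then show ?thesis by (simp add: h0 g0)
  qed
  have h_bound: "\<bar>h k t\<bar> \<le> fact k * (8 * M * L (real k - 1)) ^ k" if k: "k \<ge> 1" for k t
  proof -
    let ?R = "4 * M * L (real k - 1)"
    have R: "?R \<ge> 0" using M0 L0 k by simp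
    \<comment> \<open>up to order \<open>k\<close>, monotonicity of \<open>L\<close> permits a single geometric rate\<close>
    have "\<bar>\<theta> j t\<bar> \<le> 2 * (fact j * ?R ^ j)" if j: "1 \<le> j" "j \<le> k" for j
    proof -
      have "L (real j - 1) \<le> L (real k - 1)"
        using assms(2) j by (auto simp: mono_on_def)
      then have "fact j * (4 * M * L (real j - 1)) ^ j \<le> fact j * ?R ^ j"
        using M0 L0 j by (intro mult_left_mono power_mono) auto
      then have "\<bar>g j t\<bar> \<le> fact j * ?R ^ j" using g_bound[OF j(1), of t] by linarith
      then have "pi / 2 * \<bar>g j t\<bar> \<le> 2 * (fact j * ?R ^ j)"
        using pi_half_le_two by (intro mult_mono) auto
      then show ?thesis by (simp add: \<theta>_def abs_mult)
    qed
    then have "norm (cis_tower \<theta> k t) \<le> fact k * (2 * ?R) ^ k"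
      using R by (intro cis_tower_bound[where K = k]) auto
    also have "2 * ?R = 8 * M * L (real k - 1)" by simp
    finally show ?thesis
      unfolding h_def by (rule order_trans[OF abs_Im_le_cmod])
  qed
  have c: "h 0 \<in> S_one L 8 (8 * M)" "admissible_c (h 0)" "h 0 ` {0..} \<subseteq> {0..1}"
  proof -
    show "h 0 \<in> S_one L 8 (8 * M)"
    proof (rule tower_S_one[OF h])
      show "\<bar>h 0 t\<bar> \<le> 8" for t using h_range[of t] by simp
      show "\<bar>h k t\<bar> \<le> fact k * (8 * (8 * M * L (real k - 1)) ^ k)" if "k \<ge> 1" for k t
      proof -
        have "0 \<le> fact k * (8 * M * L (real k - 1)) ^ k" using M0 L0 that by simp
        then show ?thesis using h_bound[OF that, of t] by simp
      qed
    qed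
    have s: "supp (h 0) \<subseteq> {1/2..2}"
    proof (rule supp_subset)
      show "1/2 \<le> t \<and> t \<le> 2" if "0 \<le> t" "h 0 t \<noteq> 0" for t
        by (rule g_supp) (use that in \<open>auto simp: h0 g0\<close>)
    qed
    have "h k 0 = 0" if "k \<ge> 1" for k
      using that by (cases k) (auto simp: h_def \<theta>_def g_0)
    then have "admissible (h 0)"
      using s by (intro tower_admissible h) auto
    then show "admissible_c (h 0)"
      using s dyadic_sum_of_squares[of "f 0", OF one zero] by (simp add: admissible_c_def h0)
    show "h 0 ` {0..} \<subseteq> {0..1}" using h_range by blast
  qed
  show ?thesis using a b c by blast
qed

end
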